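(* Let $G$ be an infinite group that is weakly geodesically automatic with respect to a finite generating set $A$. Then $G$ has a uniform bound on depth with respect to $A$: there is an integer $K$ such that every $g\in G$ has depth at most $K$ with respect to $A$.
   Context: For a group $G$ with finite generating set $A$, $d_A$ denotes the word metric with respect to $A$. A word over $A\cup A^{-1}$ is geodesic if its length equals $d_A(1,g)$, where $g$ is the element it represents. For $G$ infinite, the depth of $g\in G$ with respect to $A$ is the $d_A$-distance from $g$ to the complement in $G$ of the closed ball of radius $d_A(1,g)$ about the identity. A group is weakly geodesically automatic (with respect to $A$) if it admits an automatic structure (in the usual sense: a regular language over $A\cup A^{-1}$ mapping onto $G$, together with the multiplier automata) over $A$ whose language consists entirely of geodesic words. *)

theory Defs
  imports "HOL-Algebra.Generated_Groups"
begin

section \<open>Finite state automata\<close>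

record ('s, 'q) dfa =
  states :: "'q set"
  start :: 'q
  accepting :: "'q set"
  trans_fun :: "'q \<Rightarrow> 's \<Rightarrow> 'q"

definition is_dfa :: "'s set \<Rightarrow> ('s, 'q) dfa \<Rightarrow> bool" where
  "is_dfa S M \<longleftrightarrow>
     finite S \<and> finite (states M) \<and> start M \<in> states M \<and> accepting M \<subseteq> states M \<and>
     (\<forall>q\<in>states M. \<forall>a\<in>S. trans_fun M q a \<in> states M)"

definition dfa_lang :: "'s set \<Rightarrow> ('s, 'q) dfa \<Rightarrow> 's list set" where
  "dfa_lang S M = {w \<in> lists S. foldl (trans_fun M) (start M) w \<in> accepting M}"

text \<open>
  Pairs of words are read by an automaton synchronously, letter by letter, the shorter word
  being padded at its end by the symbol \<^term>\<open>None\<close>.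
\<close>

definition padded_alphabet :: "'s set \<Rightarrow> ('s option \<times> 's option) set" where
  "padded_alphabet S = (insert None (Some ` S)) \<times> (insert None (Some ` S)) - {(None, None)}"

fun padded_pair :: "'s list \<Rightarrow> 's list \<Rightarrow> ('s option \<times> 's option) list" where
  "padded_pair [] [] = []"
| "padded_pair (x # xs) [] = (Some x, None) # padded_pair xs []"
| "padded_pair [] (y # ys) = (None, Some y) # padded_pair [] ys"
| "padded_pair (x # xs) (y # ys) = (Some x, Some y) # padded_pair xs ys"


section \<open>Words and the word metric\<close>

text \<open>Letters are elements of the group; no symbol is distinguished from the element it names.\<close>

definition letters :: "('a, 'b) monoid_scheme \<Rightarrow> 'a set \<Rightarrow> 'a set" where
  "letters G A = A \<union> (\<lambda>a. inv\<^bsub>G\<^esub> a) ` A"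

definition word_eval :: "('a, 'b) monoid_scheme \<Rightarrow> 'a list \<Rightarrow> 'a" where
  "word_eval G w = foldr (\<lambda>x y. x \<otimes>\<^bsub>G\<^esub> y) w \<one>\<^bsub>G\<^esub>"

definition word_dist :: "('a, 'b) monoid_scheme \<Rightarrow> 'a set \<Rightarrow> 'a \<Rightarrow> 'a \<Rightarrow> nat" where
  "word_dist G A g h =
     (LEAST n. \<exists>w\<in>lists (letters G A). length w = n \<and> g \<otimes>\<^bsub>G\<^esub> word_eval G w = h)"

definition geodesic_word :: "('a, 'b) monoid_scheme \<Rightarrow> 'a set \<Rightarrow> 'a list \<Rightarrow> bool" where
  "geodesic_word G A w \<longleftrightarrow>
     w \<in> lists (letters G A) \<and> length w = word_dist G A \<one>\<^bsub>G\<^esub> (word_eval G w)"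

definition closed_word_ball :: "('a, 'b) monoid_scheme \<Rightarrow> 'a set \<Rightarrow> 'a \<Rightarrow> nat \<Rightarrow> 'a set" where
  "closed_word_ball G A g r = {h \<in> carrier G. word_dist G A g h \<le> r}"

text \<open>
  On \<^typ>\<open>nat\<close> the infimum of a nonempty set is its least element.  The set below is nonempty
  when \<open>G\<close> is infinite and \<open>A\<close> is a finite generating set, balls then being finite; for finite
  \<open>G\<close> the value is a meaningless \<open>0\<close> at elements of maximal length.
\<close>

definition depth :: "('a, 'b) monoid_scheme \<Rightarrow> 'a set \<Rightarrow> 'a \<Rightarrow> nat" where
  "depth G A g =
     (INF h \<in> carrier G - closed_word_ball G A \<one>\<^bsub>G\<^esub> (word_dist G A \<one>\<^bsub>G\<^esub> g). word_dist G A g h)"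


section \<open>Automatic structures\<close>

text \<open>
  \<open>W\<close> is the word acceptor.  The multiplier \<open>M None\<close> is the one for the empty word (equality of
  represented elements), and \<open>M (Some x)\<close> the one for right multiplication by the letter \<open>x\<close>.
\<close>

definition automatic_structure ::
  "('a, 'b) monoid_scheme \<Rightarrow> 'a set \<Rightarrow> ('a, 'q) dfa \<Rightarrow>
     ('a option \<Rightarrow> ('a option \<times> 'a option, 'r) dfa) \<Rightarrow> bool" where
  "automatic_structure G A W M \<longleftrightarrow>
     (let S = letters G A; L = dfa_lang S W in
        is_dfa S W \<and>
        word_eval G ` L = carrier G \<and>
        (\<forall>m \<in> insert None (Some ` S).
           is_dfa (padded_alphabet S) (M m) \<and>
           dfa_lang (padded_alphabet S) (M m) =
             {padded_pair u v | u v. u \<in> L \<and> v \<in> L \<and>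
                word_eval G u \<otimes>\<^bsub>G\<^esub> (case m of None \<Rightarrow> \<one>\<^bsub>G\<^esub> | Some x \<Rightarrow> x) = word_eval G v}))"

text \<open>
  State sets being finite, taking the states to be natural numbers loses no generality.
\<close>

definition weakly_geodesically_automatic :: "('a, 'b) monoid_scheme \<Rightarrow> 'a set \<Rightarrow> bool" where
  "weakly_geodesically_automatic G A \<longleftrightarrow>
     (\<exists>(W :: ('a, nat) dfa) (M :: 'a option \<Rightarrow> ('a option \<times> 'a option, nat) dfa).
        automatic_structure G A W M \<and>
        (\<forall>w \<in> dfa_lang (letters G A) W. geodesic_word G A w))"

end

theory Submission
  imports Defs
begin

text \<open>
  The language \<open>L\<close> of a geodesic automatic structure is regular and represents every
  element of \<open>G\<close> by geodesics.  Call a state of the word acceptor live if infinitely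
  many words lead from it to acceptance.  As \<open>G\<close> is infinite, so is \<open>L\<close>,
  and the start state is live.  Let \<open>w \<in> L\<close> represent \<open>g\<close>, and write
  \<open>w = u @ v\<close> with \<open>u\<close> the longest prefix that leads to a live state.
  The first letter of \<open>v\<close>, if there is one, enters a state from which only finitely
  many words are accepted; there being finitely many states, the length of \<open>v\<close> is
  bounded independently of \<open>w\<close>.  On the other hand \<open>u\<close> ends in a live
  state, so it has a continuation \<open>x\<close> with \<open>u @ x \<in> L\<close> that is
  longer than this bound, hence longer than \<open>v\<close>, and one such \<open>x\<close> chosen
  for each live state has bounded length as well.  This is
  \<open>infinite_regular_lengthening\<close>.

  The word \<open>u @ x\<close> is geodesic and longer than the geodesic \<open>w\<close>, so its value lies
  outside the ball of radius \<open>d(1, g)\<close>.  Undoing \<open>v\<close> and then reading \<open>x\<close> leads from \<open>g\<close> to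
  that value (\<open>word_dist_common_prefix_le\<close>), so the depth of \<open>g\<close> is at most the bounded number
  \<open>length v + length x\<close>.
\<close>

section \<open>Lengthening words of an infinite regular language\<close>

definition accepted_from :: "'s set \<Rightarrow> ('s, 'q) dfa \<Rightarrow> 'q \<Rightarrow> 's list set" where
  "accepted_from S M q = {w \<in> lists S. foldl (trans_fun M) q w \<in> accepting M}"

lemma accepted_from_Cons:
  "a # w \<in> accepted_from S M q \<longleftrightarrow> a \<in> S \<and> w \<in> accepted_from S M (trans_fun M q a)"
  by (auto simp: accepted_from_def)

lemma dfa_lang_eq_accepted_from: "dfa_lang S M = accepted_from S M (start M)"
  by (simp add: dfa_lang_def accepted_from_def)

lemma infinite_lists_obtain_longer:
  assumes "finite S" "infinite X" "X \<subseteq> lists S"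
  obtains x where "x \<in> X" "n < length x"
proof -
  have "\<not> X \<subseteq> {w. set w \<subseteq> S \<and> length w \<le> n}"
    using finite_lists_length_le[OF assms(1)] assms(2) finite_subset by blast
  then obtain x where "x \<in> X" "n < length x"
    using assms(3) by (fastforce simp: in_lists_conv_set)
  then show thesis by (rule that)
qed

text \<open>
  Follow the run of \<open>w\<close> until it is about to leave the states that accept infinitely many words.
  What is left of \<open>w\<close> is then short, and it can be replaced by a longer word accepted from the
  current state.  Since there are finitely many states, the bounds that hold at each of them
  combine into the single \<open>D\<close>.
\<close>

lemma infinite_regular_lengthening:
  assumes dfa: "is_dfa S M" and inf: "infinite (dfa_lang S M)"
  shows "\<exists>D. \<forall>w \<in> dfa_lang S M. \<exists>u v x. w = u @ v \<and> u @ x \<in> dfa_lang S M \<and>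
           length v < length x \<and> length v + length x \<le> D"
proof -
  let ?E = "accepted_from S M"
  have finS: "finite S" and finQ: "finite (states M)" and start: "start M \<in> states M"
    and step: "\<And>q a. q \<in> states M \<Longrightarrow> a \<in> S \<Longrightarrow> trans_fun M q a \<in> states M"
    using dfa by (auto simp: is_dfa_def)
  define dead_words where "dead_words = (\<Union>q \<in> {q \<in> states M. finite (?E q)}. ?E q)"
  have "finite dead_words"
    using finQ by (auto simp: dead_words_def)
  then obtain C where C: "\<And>w. w \<in> dead_words \<Longrightarrow> length w \<le> C"
    using finite_maxlen[of dead_words] less_imp_le by blast
  \<comment> \<open>A word accepted from a live state whose first letter enters a dead state has length at most
    \<open>Suc C\<close> (dead states being those that accept finitely many words), so this is the length that
    the replacement words have to exceed.\<close>
  have "\<exists>x. x \<in> ?E q \<and> Suc C < length x" if "infinite (?E q)" for q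
  proof -
    have "?E q \<subseteq> lists S" by (auto simp: accepted_from_def)
    from infinite_lists_obtain_longer[OF finS that this, of "Suc C"] show ?thesis by blast
  qed
  then obtain ext where ext: "\<And>q. infinite (?E q) \<Longrightarrow> ext q \<in> ?E q \<and> Suc C < length (ext q)"
    by metis
  have "finite (ext ` states M)" using finQ by simp
  then obtain B where B: "\<And>q. q \<in> states M \<Longrightarrow> length (ext q) \<le> B"
    using finite_maxlen[of "ext ` states M"] less_imp_le by blast
  have lengthen: "\<exists>u v x. w = u @ v \<and> u @ x \<in> ?E q \<and> length v < length x \<and>
      length v + length x \<le> Suc C + B"
    if "q \<in> states M" "infinite (?E q)" "w \<in> ?E q" for w q
    using that
  proof (induction w arbitrary: q)
    case Nil
    then show ?case
      using ext[of q] B[of q] by (intro exI[of _ "[]"] exI[of _ "ext q"]) auto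
  next
    case (Cons a w)
    then have a: "a \<in> S" and w: "w \<in> ?E (trans_fun M q a)"
      by (auto simp: accepted_from_Cons)
    have state: "trans_fun M q a \<in> states M"
      using step Cons.prems(1) a by blast
    show ?case
    proof (cases "finite (?E (trans_fun M q a))")
      case True
      then have "length w \<le> C"
        using w state by (intro C) (auto simp: dead_words_def)
      then show ?thesis
        using ext[of q] B[of q] Cons.prems
        by (intro exI[of _ "[]"] exI[of _ "a # w"] exI[of _ "ext q"]) auto
    next
      case False
      from Cons.IH[OF state this w] obtain u v x where
        "w = u @ v" "u @ x \<in> ?E (trans_fun M q a)" "length v < length x"
        "length v + length x \<le> Suc C + B"
        by blast
      then show ?thesis
        using a by (intro exI[of _ "a # u"] exI[of _ v] exI[of _ x])
          (auto simp: accepted_from_Cons)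
    qed
  qed
  show ?thesis
    using lengthen[OF start] inf unfolding dfa_lang_eq_accepted_from by blast
qed


section \<open>Words with a common prefix\<close>

lemma word_eval_Nil [simp]: "word_eval G [] = \<one>\<^bsub>G\<^esub>"
  by (simp add: word_eval_def)

lemma word_eval_Cons [simp]: "word_eval G (a # w) = a \<otimes>\<^bsub>G\<^esub> word_eval G w"
  by (simp add: word_eval_def)

context group
begin

lemma word_eval_closed: "w \<in> lists (carrier G) \<Longrightarrow> word_eval G w \<in> carrier G"
  by (induction w) auto

lemma word_eval_append:
  assumes "u \<in> lists (carrier G)" "v \<in> lists (carrier G)"
  shows "word_eval G (u @ v) = word_eval G u \<otimes> word_eval G v"
  using assms by (induction u) (auto simp: word_eval_closed m_assoc)

lemma word_eval_inverse:
  assumes "w \<in> lists (carrier G)"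
  shows "word_eval G (rev (map (m_inv G) w)) = inv (word_eval G w)"
  using assms
proof (induction w)
  case (Cons a w)
  have "rev (map (m_inv G) w) \<in> lists (carrier G)" and "[inv a] \<in> lists (carrier G)"
    using Cons.hyps by auto
  then have "word_eval G (rev (map (m_inv G) (a # w)))
      = word_eval G (rev (map (m_inv G) w)) \<otimes> word_eval G [inv a]"
    by (simp only: word_eval_append list.map rev.simps)
  then show ?case
    using Cons by (simp add: inv_mult_group word_eval_closed)
qed simp

lemma letters_subset_carrier: "A \<subseteq> carrier G \<Longrightarrow> letters G A \<subseteq> carrier G"
  by (auto simp: letters_def)

lemma inv_in_letters:
  assumes "A \<subseteq> carrier G" "a \<in> letters G A"
  shows "inv a \<in> letters G A"
  using assms by (auto simp: letters_def subset_iff)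

lemma word_dist_le_length:
  "w \<in> lists (letters G A) \<Longrightarrow> g \<otimes> word_eval G w = h \<Longrightarrow> word_dist G A g h \<le> length w"
  unfolding word_dist_def by (rule Least_le) blast

lemma word_dist_common_prefix_le:
  assumes A: "A \<subseteq> carrier G"
    and words: "u \<in> lists (letters G A)" "v \<in> lists (letters G A)" "x \<in> lists (letters G A)"
  shows "word_dist G A (word_eval G (u @ v)) (word_eval G (u @ x)) \<le> length v + length x"
proof -
  let ?p = "rev (map (m_inv G) v) @ x"
  have car: "u \<in> lists (carrier G)" "v \<in> lists (carrier G)" "x \<in> lists (carrier G)"
    using words letters_subset_carrier[OF A] by auto
  then have car_inv: "rev (map (m_inv G) v) \<in> lists (carrier G)"
    by auto
  have path: "?p \<in> lists (letters G A)"
    using words inv_in_letters[OF A] by auto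
  have "word_eval G (u @ v) \<otimes> word_eval G ?p = word_eval G (u @ x)"
  proof -
    let ?u = "word_eval G u" and ?v = "word_eval G v" and ?x = "word_eval G x"
    have "word_eval G (u @ v) \<otimes> word_eval G ?p = (?u \<otimes> ?v) \<otimes> (inv ?v \<otimes> ?x)"
      using car car_inv by (simp only: word_eval_append word_eval_inverse append_in_lists_conv)
    also have "\<dots> = ?u \<otimes> ((?v \<otimes> inv ?v) \<otimes> ?x)"
      using car by (simp only: m_assoc word_eval_closed inv_closed m_closed)
    also have "\<dots> = word_eval G (u @ x)"
      using car by (simp add: word_eval_append word_eval_closed)
    finally show ?thesis .
  qed
  from word_dist_le_length[OF path this] show ?thesis by simp
qed

end

lemma depth_le_word_dist:
  assumes "h \<in> carrier G" "word_dist G A \<one>\<^bsub>G\<^esub> g < word_dist G A \<one>\<^bsub>G\<^esub> h"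
  shows "depth G A g \<le> word_dist G A g h"
  unfolding depth_def
  by (rule cINF_lower) (use assms in \<open>auto simp: closed_word_ball_def\<close>)


section \<open>The bound on depth\<close>

theorem corollary2:
  fixes G :: "('a, 'b) monoid_scheme" and A :: "'a set"
  assumes "group G"
    and "infinite (carrier G)"
    and "finite A"
    and "A \<subseteq> carrier G"
    and "generate G A = carrier G"
    and "weakly_geodesically_automatic G A"
  shows "\<exists>K :: nat. \<forall>g \<in> carrier G. depth G A g \<le> K"
proof -
  interpret group G by fact
  obtain W :: "('a, nat) dfa" and M :: "'a option \<Rightarrow> ('a option \<times> 'a option, nat) dfa"
    where aut: "automatic_structure G A W M"
      and geo: "\<And>w. w \<in> dfa_lang (letters G A) W \<Longrightarrow> geodesic_word G A w"
    using assms(6) unfolding weakly_geodesically_automatic_def by blast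
  define L where "L = dfa_lang (letters G A) W"
  have dfa: "is_dfa (letters G A) W" and onto: "word_eval G ` L = carrier G"
    using aut by (simp_all add: automatic_structure_def Let_def L_def)
  have "infinite L"
    using onto assms(2) by (metis finite_imageI)
  then obtain D where D: "\<forall>w \<in> L. \<exists>u v x. w = u @ v \<and> u @ x \<in> L \<and>
      length v < length x \<and> length v + length x \<le> D"
    using infinite_regular_lengthening[OF dfa] unfolding L_def by blast
  have "depth G A g \<le> D" if "g \<in> carrier G" for g
  proof -
    have "g \<in> word_eval G ` L"
      using that by (simp only: onto)
    then obtain w where w: "w \<in> L" "g = word_eval G w"
      by (elim imageE)
    obtain u v x where uvx: "w = u @ v" "u @ x \<in> L" "length v < length x"
        "length v + length x \<le> D"
      using D w(1) by blast
    let ?h = "word_eval G (u @ x)"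
    have geo_w: "geodesic_word G A (u @ v)" and geo_h: "geodesic_word G A (u @ x)"
      using geo w(1) uvx(1,2) by (auto simp: L_def)
    have "?h \<in> carrier G"
      using imageI[OF uvx(2), of "word_eval G"] by (simp only: onto)
    moreover have "word_dist G A \<one>\<^bsub>G\<^esub> g < word_dist G A \<one>\<^bsub>G\<^esub> ?h"
      using geo_w geo_h uvx(1,3) w(2) unfolding geodesic_word_def by simp
    ultimately have "depth G A g \<le> word_dist G A g ?h"
      by (rule depth_le_word_dist)
    also have "\<dots> \<le> length v + length x"
      using word_dist_common_prefix_le[OF assms(4), of u v x] geo_w geo_h w(2) uvx(1)
      by (simp add: geodesic_word_def)
    finally show ?thesis
      using uvx(4) by linarith
  qed
  then show ?thesis by blast
qed

end
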